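(* Let $t\ge 2$ be an integer and let $G$ be a $t$-sail. Then the tree-width of $G$ satisfies $\operatorname{tw}(G)\ge t-1$.
   Context: Graphs are simple and undirected. A finite graph $(V,E)$ is a path-star graph if $E$ can be partitioned into two sets $E_P$ and $E_S$ such that $(V,E_P)$ is a forest of paths and $(V,E_S)$ is a forest of stars (a star is a complete bipartite graph $K_{1,k}$; isolated vertices are allowed as trivial components). A path-star graph $(V,E_P\cup E_S)$ is a $t$-sail if there is a set $V_S=\{s_1,\dots,s_t\}\subseteq V$ of $t$ vertices such that: (1) no edge in $E_P$ is incident with a vertex in $V_S$; (2) the graph $(V\setminus V_S,E_P)$ has exactly $t$ components $P_1,\dots,P_t$, all of which are paths; (3) for all $1\le i\le j\le t$ there exists a vertex $v$ of $P_i$ such that $s_jv\in E_S$. *)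

theory Defs
  imports Complex_Main
begin

text \<open>
  A graph is given by a vertex set \<open>V\<close> and an edge set \<open>E\<close>, where an edge is the two-element
  set of its endpoints.
\<close>

definition simple_graph :: "'a set \<Rightarrow> 'a set set \<Rightarrow> bool" where
  "simple_graph V E \<longleftrightarrow> finite V \<and> (\<forall>e\<in>E. e \<subseteq> V \<and> card e = 2)"

definition adj_rel :: "'a set set \<Rightarrow> ('a \<times> 'a) set" where
  "adj_rel E = {(u, v). {u, v} \<in> E}"

definition induced_edges :: "'a set set \<Rightarrow> 'a set \<Rightarrow> 'a set set" where
  "induced_edges E U = {e \<in> E. e \<subseteq> U}"

definition connected_graph :: "'a set \<Rightarrow> 'a set set \<Rightarrow> bool" where
  "connected_graph V E \<longleftrightarrow> V \<noteq> {} \<and> (\<forall>u\<in>V. \<forall>v\<in>V. (u, v) \<in> (adj_rel E)\<^sup>*)"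

text \<open>
  Components are represented by their vertex sets; the component with vertex set \<open>C\<close> is the
  graph \<open>(C, induced_edges E C)\<close>.
\<close>

definition graph_components :: "'a set \<Rightarrow> 'a set set \<Rightarrow> 'a set set" where
  "graph_components V E = V // {(u, v). u \<in> V \<and> v \<in> V \<and> (u, v) \<in> (adj_rel E)\<^sup>*}"

text \<open>Cycles are listed without repeating the starting vertex.\<close>

definition is_cycle :: "'a set set \<Rightarrow> 'a list \<Rightarrow> bool" where
  "is_cycle E xs \<longleftrightarrow> length xs \<ge> 3 \<and> distinct xs \<and>
     (\<forall>i. Suc i < length xs \<longrightarrow> {xs ! i, xs ! Suc i} \<in> E) \<and> {last xs, hd xs} \<in> E"

definition tree_graph :: "'a set \<Rightarrow> 'a set set \<Rightarrow> bool" where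
  "tree_graph V E \<longleftrightarrow> simple_graph V E \<and> connected_graph V E \<and> (\<nexists>xs. is_cycle E xs)"

text \<open>A single vertex counts both as a path and as the star \<open>K\<^sub>1\<^sub>,\<^sub>0\<close>.\<close>

definition path_graph :: "'a set \<Rightarrow> 'a set set \<Rightarrow> bool" where
  "path_graph V E \<longleftrightarrow> (\<exists>xs. xs \<noteq> [] \<and> distinct xs \<and> V = set xs \<and>
     E = {{xs ! i, xs ! Suc i} | i. Suc i < length xs})"

definition star_graph :: "'a set \<Rightarrow> 'a set set \<Rightarrow> bool" where
  "star_graph V E \<longleftrightarrow> finite V \<and> (\<exists>c\<in>V. E = {{c, x} | x. x \<in> V - {c}})"

definition forest_of_paths :: "'a set \<Rightarrow> 'a set set \<Rightarrow> bool" where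
  "forest_of_paths V E \<longleftrightarrow> (\<forall>C\<in>graph_components V E. path_graph C (induced_edges E C))"

definition forest_of_stars :: "'a set \<Rightarrow> 'a set set \<Rightarrow> bool" where
  "forest_of_stars V E \<longleftrightarrow> (\<forall>C\<in>graph_components V E. star_graph C (induced_edges E C))"

text \<open>Either part of the partition of the edge set may be empty.\<close>

definition path_star_partition ::
    "'a set \<Rightarrow> 'a set set \<Rightarrow> 'a set set \<Rightarrow> 'a set set \<Rightarrow> bool" where
  "path_star_partition V E EP ES \<longleftrightarrow>
     simple_graph V E \<and> EP \<union> ES = E \<and> EP \<inter> ES = {} \<and>
     forest_of_paths V EP \<and> forest_of_stars V ES"

text \<open>
  The vertices \<open>s\<^sub>1, \<dots>, s\<^sub>t\<close> are distinct, and the components \<open>P\<^sub>1, \<dots>, P\<^sub>t\<close> are listed without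
  repetition; both are families indexed by \<open>{1..t}\<close>.
\<close>

definition sail :: "nat \<Rightarrow> 'a set \<Rightarrow> 'a set set \<Rightarrow> bool" where
  "sail t V E \<longleftrightarrow>
     (\<exists>EP ES VS s P. path_star_partition V E EP ES \<and>
        VS \<subseteq> V \<and> bij_betw s {1..t} VS \<and>
        (\<forall>e\<in>EP. e \<inter> VS = {}) \<and>
        bij_betw P {1..t} (graph_components (V - VS) EP) \<and>
        (\<forall>i\<in>{1..t}. path_graph (P i) (induced_edges EP (P i))) \<and>
        (\<forall>i j. 1 \<le> i \<and> i \<le> j \<and> j \<le> t \<longrightarrow> (\<exists>v\<in>P i. {s j, v} \<in> ES)))"

text \<open>
  Since the decomposition tree is finite, there is no loss in taking its nodes to be natural
  numbers.
\<close>

definition tree_decomposition ::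
    "'a set \<Rightarrow> 'a set set \<Rightarrow> nat set \<Rightarrow> nat set set \<Rightarrow> (nat \<Rightarrow> 'a set) \<Rightarrow> bool" where
  "tree_decomposition V E N F B \<longleftrightarrow>
     tree_graph N F \<and>
     (\<Union>n\<in>N. B n) = V \<and>
     (\<forall>e\<in>E. \<exists>n\<in>N. e \<subseteq> B n) \<and>
     (\<forall>v\<in>V. connected_graph {n \<in> N. v \<in> B n} (induced_edges F {n \<in> N. v \<in> B n}))"

definition decomposition_width :: "nat set \<Rightarrow> (nat \<Rightarrow> 'a set) \<Rightarrow> int" where
  "decomposition_width N B = int (Max ((\<lambda>n. card (B n)) ` N)) - 1"

text \<open>
  For finite \<open>V\<close> the infimum is a minimum: the set of widths is nonempty (a single bag \<open>V\<close> is a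
  tree decomposition) and bounded below by \<open>-1\<close>.
\<close>

definition treewidth :: "'a set \<Rightarrow> 'a set set \<Rightarrow> int" where
  "treewidth V E =
     Inf {decomposition_width N B | N F B. tree_decomposition V E N F B}"

end

theory Submission
  imports Defs
begin

text \<open>
  A \<open>t\<close>-sail contains \<open>K\<^sub>t\<close> as a minor: the sets \<open>P\<^sub>i \<union> {s\<^sub>i}\<close> are connected and pairwise
  disjoint, and for \<open>i < j\<close> some edge joins \<open>s\<^sub>j\<close> to \<open>P\<^sub>i\<close>. It remains to see that a \<open>K\<^sub>t\<close> minor
  with branch sets \<open>M\<^sub>1, \<dots>, M\<^sub>t\<close> forces tree-width at least \<open>t - 1\<close> (lemma
  \<open>treewidth_ge_if_complete_minor\<close>).

  In a tree decomposition, the nodes whose bags meet a connected vertex set form a subtree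
  (lemma \<open>connected_bags_meeting\<close>). The subtrees of \<open>M\<^sub>i\<close> and \<open>M\<^sub>j\<close> share a node, namely one whose
  bag contains an edge between \<open>M\<^sub>i\<close> and \<open>M\<^sub>j\<close>. By the Helly property of subtrees
  (lemma \<open>subtrees_Helly\<close>) some bag meets all the branch sets, and as these are disjoint, that bag
  has at least \<open>t\<close> elements.
\<close>

section \<open>Reachability\<close>

lemma adj_rel_rtrancl_sym:
  assumes "(u, v) \<in> (adj_rel E)\<^sup>*"
  shows "(v, u) \<in> (adj_rel E)\<^sup>*"
proof -
  have "sym (adj_rel E)"
    by (auto simp: sym_def adj_rel_def insert_commute)
  then show ?thesis
    using assms by (meson sym_rtrancl symD)
qed

lemma adj_rel_rtrancl_mono:
  assumes "(u, v) \<in> (adj_rel E)\<^sup>*" and "E \<subseteq> E'"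
  shows "(u, v) \<in> (adj_rel E')\<^sup>*"
proof -
  have "adj_rel E \<subseteq> adj_rel E'"
    using assms(2) by (auto simp: adj_rel_def)
  then show ?thesis
    using assms(1) rtrancl_mono by blast
qed

lemma induced_edges_mono: "E \<subseteq> E' \<Longrightarrow> U \<subseteq> U' \<Longrightarrow> induced_edges E U \<subseteq> induced_edges E' U'"
  by (auto simp: induced_edges_def)

lemma adj_rel_induced_edges_iff:
  "(u, v) \<in> adj_rel (induced_edges E U) \<longleftrightarrow> {u, v} \<in> E \<and> u \<in> U \<and> v \<in> U"
  by (auto simp: adj_rel_def induced_edges_def)

lemma connected_graph_if_reachable_from:
  assumes "r \<in> U" and "\<And>u. u \<in> U \<Longrightarrow> (r, u) \<in> (adj_rel E)\<^sup>*"
  shows "connected_graph U E"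
proof -
  have "(u, v) \<in> (adj_rel E)\<^sup>*" if "u \<in> U" "v \<in> U" for u v
    using assms(2)[OF that(1), THEN adj_rel_rtrancl_sym] assms(2)[OF that(2)]
    by (rule rtrancl_trans)
  then show ?thesis
    using assms(1) unfolding connected_graph_def by blast
qed

lemma connected_graph_mono:
  assumes "connected_graph V E" and "E \<subseteq> E'"
  shows "connected_graph V E'"
proof -
  have "(u, v) \<in> (adj_rel E')\<^sup>*" if "u \<in> V" "v \<in> V" for u v
  proof (rule adj_rel_rtrancl_mono[OF _ \<open>E \<subseteq> E'\<close>])
    show "(u, v) \<in> (adj_rel E)\<^sup>*"
      using assms(1) that unfolding connected_graph_def by blast
  qed
  then show ?thesis
    using assms(1) unfolding connected_graph_def by blast
qed

lemma connected_graph_insert: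
  assumes conn: "connected_graph U (induced_edges E U)" and "v \<in> U" and "{x, v} \<in> E"
  shows "connected_graph (insert x U) (induced_edges E (insert x U))"
proof (rule connected_graph_if_reachable_from)
  let ?E = "induced_edges E (insert x U)"
  have mono: "induced_edges E U \<subseteq> ?E"
    by (intro induced_edges_mono) auto
  show "v \<in> insert x U"
    using \<open>v \<in> U\<close> by simp
  fix u assume "u \<in> insert x U"
  then show "(v, u) \<in> (adj_rel ?E)\<^sup>*"
  proof
    assume "u = x"
    then have "(v, u) \<in> adj_rel ?E"
      using assms by (auto simp: adj_rel_induced_edges_iff insert_commute)
    then show ?thesis ..
  next
    assume "u \<in> U"
    then show ?thesis
      using conn \<open>v \<in> U\<close> mono unfolding connected_graph_def
      by (blast intro: adj_rel_rtrancl_mono)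
  qed
qed

lemma connected_if_path_graph:
  assumes "path_graph V E"
  shows "connected_graph V E"
proof -
  obtain xs where ne: "xs \<noteq> []" and V: "V = set xs"
    and E: "E = {{xs ! i, xs ! Suc i} | i. Suc i < length xs}"
    using assms unfolding path_graph_def by blast
  have reach: "(xs ! 0, xs ! k) \<in> (adj_rel E)\<^sup>*" if "k < length xs" for k
    using that
  proof (induction k)
    case 0
    show ?case by simp
  next
    case (Suc k)
    then have "(xs ! k, xs ! Suc k) \<in> adj_rel E"
      unfolding adj_rel_def E by blast
    then show ?case
      using Suc by (meson Suc_lessD rtrancl.rtrancl_into_rtrancl)
  qed
  show ?thesis
  proof (rule connected_graph_if_reachable_from)
    show "xs ! 0 \<in> V"
      using ne V by simp
    show "(xs ! 0, u) \<in> (adj_rel E)\<^sup>*" if "u \<in> V" for u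
      using that reach unfolding V in_set_conv_nth by blast
  qed
qed

section \<open>The Helly property of subtrees\<close>

text \<open>
  Take the first vertex \<open>x\<close> of a longest path inside \<open>N\<close>. By maximality every neighbour of \<open>x\<close> in
  \<open>N\<close> lies on the path, and a neighbour other than the second vertex of the path would close a
  cycle. An isolated vertex counts as a leaf here; then \<open>p\<close> is arbitrary.
\<close>

lemma acyclic_obtains_leaf:
  assumes edges: "\<And>e. e \<in> F \<Longrightarrow> card e = 2" and acyclic: "\<nexists>xs. is_cycle F xs"
    and fin: "finite N" and "N \<noteq> {}"
  obtains l p where "l \<in> N" and "\<And>x. x \<in> N \<Longrightarrow> {l, x} \<in> F \<Longrightarrow> x = p"
proof -
  define walk where "walk xs \<longleftrightarrow> xs \<noteq> [] \<and> distinct xs \<and> set xs \<subseteq> N \<and>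
    (\<forall>i. Suc i < length xs \<longrightarrow> {xs ! i, xs ! Suc i} \<in> F)" for xs
  obtain n where "n \<in> N"
    using \<open>N \<noteq> {}\<close> by blast
  then have single: "walk [n]"
    by (auto simp: walk_def)
  have bound: "length xs < Suc (card N)" if "walk xs" for xs
    using that fin unfolding walk_def
    by (metis card_mono distinct_card less_Suc_eq_le)
  obtain xs where xs: "walk xs" and longest: "\<And>ys. walk ys \<Longrightarrow> length ys \<le> length xs"
    using ex_has_greatest_nat[of walk "[n]" length "Suc (card N)"] single bound
    by (auto dest: less_imp_le)
  define l where "l = xs ! 0"
  have nonempty: "xs \<noteq> []" and dist: "distinct xs"
    and step: "\<And>i. Suc i < length xs \<Longrightarrow> {xs ! i, xs ! Suc i} \<in> F"
    using xs unfolding walk_def by auto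
  have "x = xs ! 1" if "x \<in> N" and edge: "{l, x} \<in> F" for x
  proof (rule ccontr)
    assume "x \<noteq> xs ! 1"
    have "l \<noteq> x"
      using edges[OF edge] by auto
    have "x \<in> set xs"
    proof (rule ccontr)
      assume "x \<notin> set xs"
      have "{(x # xs) ! i, (x # xs) ! Suc i} \<in> F" if "Suc i < length (x # xs)" for i
        using that step edge by (cases i) (auto simp: l_def insert_commute)
      then have "walk (x # xs)"
        using xs \<open>x \<notin> set xs\<close> \<open>x \<in> N\<close> unfolding walk_def by auto
      then show False
        using longest by fastforce
    qed
    then obtain k where k: "k < length xs" "x = xs ! k"
      unfolding in_set_conv_nth by blast
    have "k \<noteq> 0" "k \<noteq> 1"
      using \<open>x \<noteq> xs ! 1\<close> \<open>l \<noteq> x\<close> k unfolding l_def by metis+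
    moreover have "last (take (Suc k) xs) = x"
      using k by (simp add: take_Suc_conv_app_nth)
    moreover have "hd (take (Suc k) xs) = l"
      using nonempty by (simp add: l_def hd_conv_nth)
    ultimately have "is_cycle F (take (Suc k) xs)"
      using k dist step edge unfolding is_cycle_def by (auto simp: insert_commute)
    then show False
      using acyclic by blast
  qed
  moreover have "l \<in> N"
    using xs nonempty unfolding walk_def l_def by auto
  ultimately show thesis
    using that by blast
qed

lemma connected_has_neighbour:
  assumes "connected_graph T (induced_edges F T)" and "l \<in> T" and "T \<noteq> {l}"
  obtains x where "x \<in> T" and "{l, x} \<in> F"
proof -
  obtain y where "y \<in> T" "y \<noteq> l"
    using assms by blast
  then have "(l, y) \<in> (adj_rel (induced_edges F T))\<^sup>*"
    using assms unfolding connected_graph_def by blast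
  then obtain x where "(l, x) \<in> adj_rel (induced_edges F T)"
    using \<open>y \<noteq> l\<close> by (cases rule: converse_rtranclE) auto
  then show thesis
    using that by (auto simp: adj_rel_induced_edges_iff)
qed

text \<open>
  Sending the leaf to its neighbour and fixing all other vertices turns each walk in \<open>T\<close> into a
  walk that avoids the leaf.
\<close>

lemma connected_remove_leaf:
  assumes conn: "connected_graph T (induced_edges F T)" and "T \<noteq> {l}"
    and leaf: "\<And>x. x \<in> T \<Longrightarrow> {l, x} \<in> F \<Longrightarrow> x = p"
  shows "connected_graph (T - {l}) (induced_edges F (T - {l}))"
proof -
  let ?R = "adj_rel (induced_edges F T)" and ?R' = "adj_rel (induced_edges F (T - {l}))"
  define r where "r x = (if x = l then p else x)" for x
  have step: "(r x, r y) \<in> ?R'\<^sup>*" if "(x, y) \<in> ?R" for x y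
  proof -
    have xy: "{x, y} \<in> F" "x \<in> T" "y \<in> T"
      using that by (auto simp: adj_rel_induced_edges_iff)
    consider "x = l" | "x \<noteq> l" "y = l" | "x \<noteq> l" "y \<noteq> l" by blast
    then show ?thesis
    proof cases
      case 1
      then have "r x = r y"
        using leaf[of y] xy by (auto simp: r_def)
      then show ?thesis by simp
    next
      case 2
      then have "r x = r y"
        using leaf[of x] xy by (auto simp: r_def insert_commute)
      then show ?thesis by simp
    next
      case 3
      then have "(r x, r y) \<in> ?R'"
        using xy by (auto simp: r_def adj_rel_induced_edges_iff)
      then show ?thesis ..
    qed
  qed
  have walk: "(r x, r y) \<in> ?R'\<^sup>*" if "(x, y) \<in> ?R\<^sup>*" for x y
    using that by (induction rule: rtrancl_induct) (auto intro: rtrancl_trans step)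
  have "T - {l} \<noteq> {}"
    using conn \<open>T \<noteq> {l}\<close> unfolding connected_graph_def by blast
  moreover have "(x, y) \<in> ?R'\<^sup>*" if "x \<in> T - {l}" "y \<in> T - {l}" for x y
  proof -
    have "(x, y) \<in> ?R\<^sup>*"
      using conn that unfolding connected_graph_def by blast
    then show ?thesis
      using walk[of x y] that by (simp add: r_def)
  qed
  ultimately show ?thesis
    unfolding connected_graph_def by blast
qed

text \<open>
  Induction on the number of nodes, removing a leaf \<open>l\<close>. If \<open>{l}\<close> belongs to the family, then \<open>l\<close>
  lies in every member. Otherwise every member that contains \<open>l\<close> also contains the neighbour \<open>p\<close>
  of \<open>l\<close>. Two members that share \<open>l\<close> therefore share \<open>p\<close> as well, so the members still intersect
  pairwise after \<open>l\<close> is removed.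
\<close>

lemma subtrees_Helly:
  assumes edges: "\<And>e. e \<in> F \<Longrightarrow> card e = 2" and acyclic: "\<nexists>xs. is_cycle F xs"
    and "finite N" and "\<T> \<noteq> {}"
    and "\<And>T. T \<in> \<T> \<Longrightarrow> T \<subseteq> N"
    and "\<And>T. T \<in> \<T> \<Longrightarrow> connected_graph T (induced_edges F T)"
    and "\<And>S T. S \<in> \<T> \<Longrightarrow> T \<in> \<T> \<Longrightarrow> S \<inter> T \<noteq> {}"
  shows "\<exists>n\<in>N. \<forall>T\<in>\<T>. n \<in> T"
  using assms(3-)
proof (induction N arbitrary: \<T> rule: finite_psubset_induct)
  case (psubset N)
  note sub = psubset.prems(2) and conn = psubset.prems(3) and meet = psubset.prems(4)
  have "N \<noteq> {}"
    using psubset.prems(1) sub meet by blast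
  then obtain l p where l: "l \<in> N" and leaf: "\<And>x. x \<in> N \<Longrightarrow> {l, x} \<in> F \<Longrightarrow> x = p"
    using acyclic_obtains_leaf[OF edges acyclic \<open>finite N\<close>] by metis
  show ?case
  proof (cases "{l} \<in> \<T>")
    case True
    then have "l \<in> T" if "T \<in> \<T>" for T
      using meet[OF True that] by blast
    then show ?thesis
      using l by blast
  next
    case False
    have neighbour: "p \<in> T \<and> p \<noteq> l" if T: "T \<in> \<T>" "l \<in> T" for T
    proof -
      have "T \<noteq> {l}"
        using False T by blast
      then obtain x where "x \<in> T" and edge: "{l, x} \<in> F"
        using connected_has_neighbour[OF conn[OF T(1)] T(2)] by blast
      moreover from this have "x = p"
        using leaf sub T(1) by blast
      moreover have "x \<noteq> l"
        using edges[OF edge] by auto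
      ultimately show ?thesis by blast
    qed
    have "\<exists>n\<in>N - {l}. \<forall>T\<in>(\<lambda>T. T - {l}) ` \<T>. n \<in> T"
    proof (rule psubset.IH)
      show "N - {l} \<subset> N"
        using l by blast
      show "(\<lambda>T. T - {l}) ` \<T> \<noteq> {}"
        using psubset.prems(1) by blast
    next
      fix T assume "T \<in> (\<lambda>T. T - {l}) ` \<T>"
      then obtain T' where T': "T' \<in> \<T>" "T = T' - {l}" by blast
      then show "T \<subseteq> N - {l}"
        using sub by blast
      have "T' \<noteq> {l}"
        using False T'(1) by blast
      moreover have "x = p" if "x \<in> T'" "{l, x} \<in> F" for x
        using leaf that sub T'(1) by blast
      ultimately show "connected_graph T (induced_edges F T)"
        unfolding T'(2) using connected_remove_leaf[OF conn[OF T'(1)]] by blast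
    next
      fix S T assume "S \<in> (\<lambda>T. T - {l}) ` \<T>" "T \<in> (\<lambda>T. T - {l}) ` \<T>"
      then obtain S' T' where "S' \<in> \<T>" "S = S' - {l}" "T' \<in> \<T>" "T = T' - {l}" by blast
      moreover from this have "S' \<inter> T' \<noteq> {}"
        using meet by blast
      ultimately show "S \<inter> T \<noteq> {}"
        using neighbour by blast
    qed
    then obtain n where "n \<in> N - {l}" and "\<forall>T\<in>\<T>. n \<in> T - {l}"
      by auto
    then show ?thesis
      by (intro bexI[of _ n]) auto
  qed
qed

section \<open>Complete minors and tree-width\<close>

text \<open>
  A walk inside \<open>M\<close> from \<open>u\<close> to \<open>v\<close> lifts to a walk in the decomposition tree: the subtrees of two
  consecutive vertices share a node whose bag contains the edge between them.
\<close>

lemma connected_bags_meeting: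
  assumes td: "tree_decomposition V E N F B"
    and "M \<subseteq> V" and conn: "connected_graph M (induced_edges E M)"
  defines "T \<equiv> {n \<in> N. B n \<inter> M \<noteq> {}}"
  shows "connected_graph T (induced_edges F T)"
proof -
  let ?R = "adj_rel (induced_edges F T)"
  have cover: "(\<Union>n\<in>N. B n) = V" and edge: "\<And>e. e \<in> E \<Longrightarrow> \<exists>n\<in>N. e \<subseteq> B n"
    and subtree: "\<And>v. v \<in> V \<Longrightarrow>
      connected_graph {n \<in> N. v \<in> B n} (induced_edges F {n \<in> N. v \<in> B n})"
    using td unfolding tree_decomposition_def by auto
  have same: "(m, n) \<in> ?R\<^sup>*"
    if "v \<in> M" "m \<in> N" "v \<in> B m" "n \<in> N" "v \<in> B n" for v m n
  proof (rule adj_rel_rtrancl_mono)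
    let ?Tv = "{n \<in> N. v \<in> B n}"
    show "(m, n) \<in> (adj_rel (induced_edges F ?Tv))\<^sup>*"
      using subtree[of v] that \<open>M \<subseteq> V\<close> unfolding connected_graph_def by blast
    show "induced_edges F ?Tv \<subseteq> induced_edges F T"
      by (rule induced_edges_mono) (use that in \<open>auto simp: T_def\<close>)
  qed
  have walk: "(m, n) \<in> ?R\<^sup>*"
    if "(u, v) \<in> (adj_rel (induced_edges E M))\<^sup>*"
      and "u \<in> M" "m \<in> N" "u \<in> B m" "n \<in> N" "v \<in> B n" for u v m n
    using that
  proof (induction arbitrary: n rule: rtrancl_induct)
    case base
    then show ?case
      using same by blast
  next
    case (step v w)
    then have "{v, w} \<in> E" "w \<in> M"
      by (auto simp: adj_rel_induced_edges_iff)
    then obtain k where k: "k \<in> N" "v \<in> B k" "w \<in> B k"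
      using edge by blast
    then have "(m, k) \<in> ?R\<^sup>*"
      using step by blast
    moreover have "(k, n) \<in> ?R\<^sup>*"
      using same[OF \<open>w \<in> M\<close>] k step.prems by blast
    ultimately show ?case by (rule rtrancl_trans)
  qed
  obtain v where "v \<in> M"
    using conn unfolding connected_graph_def by blast
  then have "v \<in> (\<Union>n\<in>N. B n)"
    using \<open>M \<subseteq> V\<close> cover by blast
  then have "T \<noteq> {}"
    unfolding T_def using \<open>v \<in> M\<close> by blast
  moreover have "(m, n) \<in> ?R\<^sup>*" if mn: "m \<in> T" "n \<in> T" for m n
  proof -
    obtain u v where "u \<in> M" "u \<in> B m" "v \<in> M" "v \<in> B n" "m \<in> N" "n \<in> N"
      using mn unfolding T_def by blast
    then show ?thesis
      using walk conn unfolding connected_graph_def by blast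
  qed
  ultimately show ?thesis
    unfolding connected_graph_def by blast
qed

text \<open>
  The infimum in the definition of tree-width is unspecified for an empty set of widths, so a lower
  bound on all widths yields a lower bound on the tree-width only once some decomposition exists.
\<close>

lemma trivial_tree_decomposition:
  assumes "simple_graph V E"
  shows "tree_decomposition V E {0} {} (\<lambda>_. V)"
  using assms
  unfolding tree_decomposition_def tree_graph_def simple_graph_def connected_graph_def is_cycle_def
  by auto

text \<open>The sets \<open>M i\<close> are the branch sets of a complete minor.\<close>

lemma treewidth_ge_if_complete_minor:
  assumes graph: "simple_graph V E" and I: "finite I" "I \<noteq> {}"
    and sub: "\<And>i. i \<in> I \<Longrightarrow> M i \<subseteq> V"
    and conn: "\<And>i. i \<in> I \<Longrightarrow> connected_graph (M i) (induced_edges E (M i))"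
    and disj: "\<And>i j. i \<in> I \<Longrightarrow> j \<in> I \<Longrightarrow> i \<noteq> j \<Longrightarrow> M i \<inter> M j = {}"
    and adj: "\<And>i j. i \<in> I \<Longrightarrow> j \<in> I \<Longrightarrow> i \<noteq> j \<Longrightarrow> \<exists>u\<in>M i. \<exists>v\<in>M j. {u, v} \<in> E"
  shows "treewidth V E \<ge> int (card I) - 1"
proof -
  have width: "decomposition_width N B \<ge> int (card I) - 1"
    if td: "tree_decomposition V E N F B" for N F B
  proof -
    have N: "finite N" and edges: "\<And>e. e \<in> F \<Longrightarrow> card e = 2" and acyclic: "\<nexists>xs. is_cycle F xs"
      and cover: "(\<Union>n\<in>N. B n) = V" and edge: "\<And>e. e \<in> E \<Longrightarrow> \<exists>n\<in>N. e \<subseteq> B n"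
      using td unfolding tree_decomposition_def tree_graph_def simple_graph_def by auto
    define T where "T i = {n \<in> N. B n \<inter> M i \<noteq> {}}" for i
    have T_conn: "connected_graph (T i) (induced_edges F (T i))" if "i \<in> I" for i
      unfolding T_def using connected_bags_meeting[OF td] sub conn that by blast
    have T_meet: "T i \<inter> T j \<noteq> {}" if "i \<in> I" "j \<in> I" for i j
    proof (cases "i = j")
      case True
      then show ?thesis
        using T_conn[OF that(1)] unfolding connected_graph_def by blast
    next
      case False
      then obtain u v where "u \<in> M i" "v \<in> M j" "{u, v} \<in> E"
        using adj \<open>i \<in> I\<close> \<open>j \<in> I\<close> by blast
      moreover from this obtain n where "n \<in> N" "{u, v} \<subseteq> B n"
        using edge by blast
      ultimately show ?thesis
        unfolding T_def by blast
    qed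
    have "\<exists>n\<in>N. \<forall>S\<in>T ` I. n \<in> S"
    proof (rule subtrees_Helly[OF edges acyclic N])
      show "T ` I \<noteq> {}"
        using I by blast
      show "S \<subseteq> N" if "S \<in> T ` I" for S
        using that unfolding T_def by blast
    qed (use T_conn T_meet in auto)
    then obtain n where n: "n \<in> N" and "\<forall>i\<in>I. B n \<inter> M i \<noteq> {}"
      unfolding T_def by auto
    then have "\<forall>i\<in>I. \<exists>v. v \<in> B n \<inter> M i"
      by blast
    then obtain f where f: "\<And>i. i \<in> I \<Longrightarrow> f i \<in> B n \<inter> M i"
      using bchoice[of I "\<lambda>i v. v \<in> B n \<inter> M i"] by blast
    have "inj_on f I"
    proof (rule inj_onI, rule ccontr)
      fix i j assume "i \<in> I" "j \<in> I" "f i = f j" "i \<noteq> j"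
      then show False
        using f[of i] f[of j] disj[of i j] by auto
    qed
    moreover have "f ` I \<subseteq> B n"
      using f by blast
    moreover have "finite (B n)"
      using graph cover n unfolding simple_graph_def by (metis UN_upper finite_subset)
    ultimately have "card I \<le> card (B n)"
      by (rule card_inj_on_le)
    also have "\<dots> \<le> Max ((\<lambda>n. card (B n)) ` N)"
      using N n by simp
    finally show ?thesis
      unfolding decomposition_width_def by simp
  qed
  show ?thesis
    unfolding treewidth_def
  proof (rule cInf_greatest)
    show "{decomposition_width N B | N F B. tree_decomposition V E N F B} \<noteq> {}"
      using trivial_tree_decomposition[OF graph] by blast
  qed (use width in blast)
qed

section \<open>Sails\<close>

lemma graph_components_subset: "C \<in> graph_components V E \<Longrightarrow> C \<subseteq> V"
  unfolding graph_components_def by (auto elim: quotientE)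

lemma graph_components_disjoint:
  assumes "C \<in> graph_components V E" and "D \<in> graph_components V E" and "C \<noteq> D"
  shows "C \<inter> D = {}"
proof -
  let ?R = "{(u, v). u \<in> V \<and> v \<in> V \<and> (u, v) \<in> (adj_rel E)\<^sup>*}"
  have "equiv V ?R"
  proof (rule equivI)
    show "sym ?R"
      by (rule symI) (simp add: adj_rel_rtrancl_sym)
    show "trans ?R"
      by (rule transI) (simp, metis rtrancl_trans)
  qed (auto simp: refl_on_def)
  then show ?thesis
    using quotient_disj[of V ?R C D] assms unfolding graph_components_def by blast
qed

theorem lemma2p4:
  fixes t :: nat and V :: "'a set" and E :: "'a set set"
  assumes "t \<ge> 2" and "sail t V E"
  shows "treewidth V E \<ge> int t - 1"
proof -
  obtain EP ES VS s P where psp: "path_star_partition V E EP ES"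
    and VS: "VS \<subseteq> V" and s: "bij_betw s {1..t} VS"
    and P: "bij_betw P {1..t} (graph_components (V - VS) EP)"
    and path: "\<forall>i\<in>{1..t}. path_graph (P i) (induced_edges EP (P i))"
    and sail: "\<forall>i j. 1 \<le> i \<and> i \<le> j \<and> j \<le> t \<longrightarrow> (\<exists>v\<in>P i. {s j, v} \<in> ES)"
    using \<open>sail t V E\<close> unfolding sail_def by - (erule exE conjE)+
  have graph: "simple_graph V E" and EP: "EP \<subseteq> E" and ES: "ES \<subseteq> E"
    using psp unfolding path_star_partition_def by auto
  have comp: "P i \<in> graph_components (V - VS) EP" if "i \<in> {1..t}" for i
    using P that by (rule bij_betwE[rule_format])
  have P_sub: "P i \<subseteq> V - VS" if "i \<in> {1..t}" for i
    using graph_components_subset[OF comp[OF that]] .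
  have P_disj: "P i \<inter> P j = {}" if "i \<in> {1..t}" "j \<in> {1..t}" "i \<noteq> j" for i j
    using graph_components_disjoint[OF comp[OF that(1)] comp[OF that(2)]] P that
    unfolding bij_betw_def inj_on_def by blast
  have s_in: "s i \<in> VS" if "i \<in> {1..t}" for i
    using s that by (rule bij_betwE[rule_format])
  have s_neq: "s i \<noteq> s j" if "i \<in> {1..t}" "j \<in> {1..t}" "i \<noteq> j" for i j
    using s that unfolding bij_betw_def inj_on_def by blast
  define M where "M i = insert (s i) (P i)" for i
  have "treewidth V E \<ge> int (card {1..t}) - 1"
  proof (rule treewidth_ge_if_complete_minor[OF graph, where M = M])
    show "{1..t} \<noteq> {}"
      using \<open>t \<ge> 2\<close> by simp
  next
    fix i assume i: "i \<in> {1..t}"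
    show "M i \<subseteq> V"
      using P_sub[OF i] s_in[OF i] VS unfolding M_def by blast
    have "connected_graph (P i) (induced_edges EP (P i))"
      using connected_if_path_graph[OF bspec[OF path i]] .
    then have "connected_graph (P i) (induced_edges E (P i))"
      by (rule connected_graph_mono) (rule induced_edges_mono[OF EP order_refl])
    moreover obtain v where "v \<in> P i" "{s i, v} \<in> E"
      using sail[rule_format, of i i] i ES by auto
    ultimately show "connected_graph (M i) (induced_edges E (M i))"
      unfolding M_def by (rule connected_graph_insert)
  next
    fix i j assume ij: "i \<in> {1..t}" "j \<in> {1..t}" "i \<noteq> j"
    show "M i \<inter> M j = {}"
      using P_disj[OF ij] s_neq[OF ij] P_sub[OF ij(1)] P_sub[OF ij(2)] s_in[OF ij(1)] s_in[OF ij(2)]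
      unfolding M_def by blast
    have edge: "\<exists>u\<in>M a. \<exists>v\<in>M b. {u, v} \<in> E" if "1 \<le> a" "a < b" "b \<le> t" for a b
      using sail[rule_format, of a b] that ES unfolding M_def by (auto simp: insert_commute)
    show "\<exists>u\<in>M i. \<exists>v\<in>M j. {u, v} \<in> E"
    proof (cases "i < j")
      case True
      then show ?thesis
        using edge ij by simp
    next
      case False
      then have "\<exists>v\<in>M j. \<exists>u\<in>M i. {v, u} \<in> E"
        using edge ij by simp
      then show ?thesis
        by (metis insert_commute)
    qed
  qed simp
  then show ?thesis by simp
qed

end
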